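(* If $\mathbf{f}_{i\xi}\in\mathbb{R}^3$ (indexed by material points $\xi$ of the body) are the concentrated forces imposed on affine body $i$, then Newton's second law in terms of affine coordinates is formulated as $$\mathbf{M}_i\ddot{\mathbf{q}}_i=\sum_\xi\mathbf{J}_{i\xi}^T\mathbf{f}_{i\xi},$$ where, given the mass density distribution function $\rho$ of the body, the generalized mass matrix $\mathbf{M}_i$ is the $12\times12$ block diagonal matrix $$\mathbf{M}_i=\begin{bmatrix} m_i\mathbf{I}&0&0&0\\0&\Pi_i&0&0\\0&0&\Pi_i&0\\0&0&0&\Pi_i\end{bmatrix},\qquad \Pi_i=\int_\Omega\rho\,\mathbf{x}_i\mathbf{x}_i^T\,dV .$$
   Context: An affine body $i$ has kinematics $\mathbf{y}=\mathbf{A}_i\mathbf{x}+\mathbf{c}_i$ with a time-varying linear transform $\mathbf{A}_i(t)\in\mathbb{R}^{3\times3}$ and a translation $\mathbf{c}_i(t)\in\mathbb{R}^3$, where $\mathbf{x}$ (also written $\mathbf{x}_i$) denotes material coordinates defined in body $i$'s frame, ranging over the material domain $\Omega$ of the body, and $\mathbf{y}$ the corresponding world coordinates. The generalized (affine) coordinates are $\mathbf{q}_i=(\mathbf{c}_i^T,\mathbf{a}_1^T,\mathbf{a}_2^T,\mathbf{a}_3^T)^T\in\mathbb{R}^{12}$ with $\mathbf{A}_i=[\mathbf{a}_1,\mathbf{a}_2,\mathbf{a}_3]^T$. The Jacobian is $\mathbf{J}(\mathbf{x})=[\mathbf{I}_3,\mathbf{I}_3\otimes\mathbf{x}^T]\in\mathbb{R}^{3\times12}$,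 so that $\mathbf{y}=\mathbf{J}(\mathbf{x})\mathbf{q}_i$; at the material point $\xi$ with material coordinates $\mathbf{x}_{i\xi}$ one writes $\mathbf{J}_{i\xi}=\mathbf{J}(\mathbf{x}_{i\xi})$. $\mathbf{I}=\mathbf{I}_3$ is the $3\times3$ identity, $m_i$ is the mass of body $i$, and $\Pi_i$ is called the affine moment of inertia. Newton's second law is $\rho\,\ddot{\mathbf{y}}=\mathbf{f}$ for a force density $\mathbf{f}$; concentrated forces correspond to $\mathbf{f}=\sum_\xi\mathbf{f}_{i\xi}\,\delta_{\mathbf{x}_{i\xi}}$ with $\delta_{\mathbf{x}_{i\xi}}$ the Dirac delta at $\mathbf{x}_{i\xi}$. Its formulation in terms of affine coordinates is obtained by multiplying by $\mathbf{J}^T$ and integrating over $\Omega$: $\int_\Omega\rho\,\mathbf{J}^T\ddot{\mathbf{y}}\,d\Omega=\int_\Omega\mathbf{J}^T\mathbf{f}\,d\Omega$, with $\ddot{\mathbf{y}}=\mathbf{J}\ddot{\mathbf{q}}_i$.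
   Formalization: The formal theorem additionally assumes that the origin of the body frame is the center of mass (the integral of ρx over Ω is zero); otherwise the blocks coupling c with a_1, a_2, a_3 do not vanish and the block diagonal mass matrix is wrong. *)

theory Defs
  imports "HOL-Probability.Probability"
begin

(* The index set of R^12, kept structured: Inl k is the k-th entry of the translation c,
   and Inr (r, k) is the k-th entry of a_r, the r-th row of A.  The product type 3 * 3 is
   the column index of the Kronecker product of I_3 with a row vector. *)
type_synonym aff = "3 + 3 \<times> 3"

lemma card_aff: "CARD(aff) = 12"
  by simp

definition world :: "real^3^3 \<Rightarrow> real^3 \<Rightarrow> real^3 \<Rightarrow> real^3" where
  "world A c x = A *v x + c"

definition affine_coords :: "real^3^3 \<Rightarrow> real^3 \<Rightarrow> real^aff" where
  "affine_coords A c = (\<chi> j. case j of Inl k \<Rightarrow> c $ k | Inr (r, k) \<Rightarrow> A $ r $ k)"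

definition jacobian :: "real^3 \<Rightarrow> real^aff^3" where
  "jacobian x = (\<chi> r j. case j of
      Inl k \<Rightarrow> (mat 1 :: real^3^3) $ r $ k
    | Inr (s, k) \<Rightarrow> (mat 1 :: real^3^3) $ r $ s * x $ k)"

lemma world_eq_jacobian: "world A c x = jacobian x *v affine_coords A c"
proof -
  have "(jacobian x *v affine_coords A c) $ r = world A c x $ r" for r
  proof -
    have "(jacobian x *v affine_coords A c) $ r
        = (\<Sum>j\<in>UNIV <+> UNIV. jacobian x $ r $ j * affine_coords A c $ j)"
      by (simp add: matrix_vector_mult_def)
    also have "\<dots> = (\<Sum>k\<in>UNIV. jacobian x $ r $ Inl k * affine_coords A c $ Inl k)
        + (\<Sum>j\<in>UNIV \<times> UNIV. jacobian x $ r $ Inr j * affine_coords A c $ Inr j)"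
      by (subst sum.Plus) auto
    also have "(\<Sum>k\<in>UNIV. jacobian x $ r $ Inl k * affine_coords A c $ Inl k)
        = (\<Sum>k\<in>UNIV. if r = k then c $ k else 0)"
      by (intro sum.cong) (auto simp: jacobian_def affine_coords_def mat_def)
    also have "(\<Sum>j\<in>UNIV \<times> UNIV. jacobian x $ r $ Inr j * affine_coords A c $ Inr j)
        = (\<Sum>s\<in>UNIV. \<Sum>k\<in>UNIV. jacobian x $ r $ Inr (s, k) * affine_coords A c $ Inr (s, k))"
      by (subst sum.cartesian_product) (simp add: case_prod_unfold)
    also have "\<dots> = (\<Sum>s\<in>UNIV. if r = s then (\<Sum>k\<in>UNIV. A $ s $ k * x $ k) else 0)"
      by (intro sum.cong) (auto simp: jacobian_def affine_coords_def mat_def mult.commute)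
    finally show ?thesis
      by (simp add: world_def matrix_vector_mult_def)
  qed
  then show ?thesis by (simp add: vec_eq_iff)
qed

definition twice_differentiable_on :: "(real \<Rightarrow> 'a::real_normed_vector) \<Rightarrow> real set \<Rightarrow> bool" where
  "twice_differentiable_on u T \<longleftrightarrow>
     (\<forall>s\<in>T. u differentiable (at s) \<and> (\<lambda>s. vector_derivative u (at s)) differentiable (at s))"

definition acceleration :: "(real \<Rightarrow> 'a::real_normed_vector) \<Rightarrow> real \<Rightarrow> 'a" where
  "acceleration u t = vector_derivative (\<lambda>s. vector_derivative u (at s)) (at t)"

definition mass :: "(real^3) set \<Rightarrow> (real^3 \<Rightarrow> real) \<Rightarrow> real" where
  "mass \<Omega> \<rho> = (LINT x:\<Omega>|lebesgue. \<rho> x)"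

abbreviation outer :: "real^3 \<Rightarrow> real^3^3" where
  "outer x \<equiv> (columnvector x :: real^1^3) ** (rowvector x :: real^3^1)"

definition affine_inertia :: "(real^3) set \<Rightarrow> (real^3 \<Rightarrow> real) \<Rightarrow> real^3^3" where
  "affine_inertia \<Omega> \<rho> = (LINT x:\<Omega>|lebesgue. \<rho> x *\<^sub>R outer x)"

definition mass_matrix :: "(real^3) set \<Rightarrow> (real^3 \<Rightarrow> real) \<Rightarrow> real^aff^aff" where
  "mass_matrix \<Omega> \<rho> = (\<chi> i j. case (i, j) of
      (Inl k, Inl l) \<Rightarrow> (mass \<Omega> \<rho> *\<^sub>R (mat 1 :: real^3^3)) $ k $ l
    | (Inr (r, k), Inr (s, l)) \<Rightarrow> if r = s then affine_inertia \<Omega> \<rho> $ k $ l else 0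
    | _ \<Rightarrow> 0)"

(* A force density f on the body may be singular, so it is represented, as a distribution,
   by its pairing with a matrix-valued field: phi is mapped to the integral of phi f over
   the domain. *)
type_synonym force_density = "(real^3 \<Rightarrow> real^3^aff) \<Rightarrow> real^aff"

(* The sum of f_p times the Dirac delta at X p; the Dirac measure at a is return lebesgue a. *)
definition concentrated ::
    "(real^3) set \<Rightarrow> 'p set \<Rightarrow> ('p \<Rightarrow> real^3) \<Rightarrow> ('p \<Rightarrow> real^3) \<Rightarrow> force_density" where
  "concentrated \<Omega> P X f = (\<lambda>\<phi>. \<Sum>p\<in>P. LINT x:\<Omega>|return lebesgue (X p). \<phi> x *v f p)"

(* Newton's law, density times acceleration equals force density, multiplied by the transposed
   Jacobian and integrated over the domain; y s x is the world position at time s of the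
   material point x. *)
definition newton_affine ::
    "(real^3) set \<Rightarrow> (real^3 \<Rightarrow> real) \<Rightarrow> (real \<Rightarrow> real^3 \<Rightarrow> real^3) \<Rightarrow> force_density \<Rightarrow> real \<Rightarrow> bool" where
  "newton_affine \<Omega> \<rho> y F t \<longleftrightarrow>
     (LINT x:\<Omega>|lebesgue. transpose (jacobian x) *v (\<rho> x *\<^sub>R acceleration (\<lambda>s. y s x) t))
       = F (\<lambda>x. transpose (jacobian x))"

end

theory Submission
  imports Defs
begin

text \<open>
  Both sides of the law are computed separately. The affine motion is linear in the generalized
  coordinates, so the acceleration of a material point is $J(x)$ applied to the second derivative
  of $q$, and the left-hand side becomes the integral of $\rho J^T J$ applied to it. The entries of
  $J^T J$ are $1$, $x_k$ and $x_k x_l$ up to Kronecker deltas; the mixed ones integrate to zero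
  because the origin is the center of mass.
\<close>

text \<open>A bounded linear map commutes with \<open>vector_derivative\<close>, and this is applied
  twice. It serves once with \<open>affine_coords\<close> and once with multiplication by the
  constant matrix \<open>jacobian x\<close>.\<close>

lemma twice_differentiable_on_bounded_linear:
  fixes u :: "real \<Rightarrow> 'a::real_normed_vector" and L :: "'a \<Rightarrow> 'b::real_normed_vector"
  assumes L: "bounded_linear L" and "open T" and u: "twice_differentiable_on u T"
  shows "twice_differentiable_on (\<lambda>s. L (u s)) T" (is ?diff)
    and "t \<in> T \<Longrightarrow> acceleration (\<lambda>s. L (u s)) t = L (acceleration u t)"
proof -
  have 1: "vector_derivative (\<lambda>s. L (u s)) (at s) = L (vector_derivative u (at s))"
    and 2: "(\<lambda>s. L (u s)) differentiable (at s)" if "s \<in> T" for s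
  proof -
    have "(u has_vector_derivative vector_derivative u (at s)) (at s)"
      using u that by (auto simp: twice_differentiable_on_def vector_derivative_works)
    from bounded_linear.has_vector_derivative[OF L this]
    have D: "((\<lambda>s. L (u s)) has_vector_derivative L (vector_derivative u (at s))) (at s)" .
    show "vector_derivative (\<lambda>s. L (u s)) (at s) = L (vector_derivative u (at s))"
      by (rule vector_derivative_at[OF D])
    show "(\<lambda>s. L (u s)) differentiable (at s)"
      using D by (rule differentiableI_vector)
  qed
  have 3: "((\<lambda>s. vector_derivative (\<lambda>s. L (u s)) (at s)) has_vector_derivative
      L (acceleration u s)) (at s)" if "s \<in> T" for s
  proof -
    have "((\<lambda>s. vector_derivative u (at s)) has_vector_derivative acceleration u s) (at s)"
      using u that by (auto simp: twice_differentiable_on_def vector_derivative_works acceleration_def)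
    from bounded_linear.has_vector_derivative[OF L this] show ?thesis
      \<comment> \<open>Fact 1 holds only on \<open>T\<close>; openness makes \<open>T\<close> a
        neighbourhood of \<open>s\<close>, so the two first derivatives agree near \<open>s\<close>
        and can be exchanged under the second derivative.\<close>
      by (rule has_vector_derivative_transform_within_open[OF _ \<open>open T\<close> that]) (simp add: 1)
  qed
  show ?diff
    unfolding twice_differentiable_on_def using 2 differentiableI_vector[OF 3] by blast
  show "acceleration (\<lambda>s. L (u s)) t = L (acceleration u t)" if "t \<in> T"
    unfolding acceleration_def[of "\<lambda>s. L (u s)"] using vector_derivative_at[OF 3[OF that]] .
qed

text \<open>Joins \<open>A\<close> and \<open>c\<close> into one curve, of which the generalized
  coordinates are a linear image.\<close>

lemma twice_differentiable_on_Pair: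
  fixes u :: "real \<Rightarrow> 'a::real_normed_vector" and v :: "real \<Rightarrow> 'b::real_normed_vector"
  assumes "open T" and u: "twice_differentiable_on u T" and v: "twice_differentiable_on v T"
  shows "twice_differentiable_on (\<lambda>s. (u s, v s)) T"
proof -
  let ?du = "\<lambda>s. vector_derivative u (at s)" and ?dv = "\<lambda>s. vector_derivative v (at s)"
  have 1: "((\<lambda>s. (u s, v s)) has_vector_derivative (?du s, ?dv s)) (at s)" if "s \<in> T" for s
    using u v that
    by (intro has_vector_derivative_Pair)
      (auto simp: twice_differentiable_on_def vector_derivative_works)
  have 2: "((\<lambda>s. vector_derivative (\<lambda>s. (u s, v s)) (at s)) has_vector_derivative
      (vector_derivative ?du (at s), vector_derivative ?dv (at s))) (at s)" if "s \<in> T" for s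
  proof -
    have "((\<lambda>s. (?du s, ?dv s)) has_vector_derivative
        (vector_derivative ?du (at s), vector_derivative ?dv (at s))) (at s)"
      using u v that
      by (intro has_vector_derivative_Pair)
        (auto simp: twice_differentiable_on_def vector_derivative_works)
    then show ?thesis
      by (rule has_vector_derivative_transform_within_open[OF _ \<open>open T\<close> that])
        (simp add: vector_derivative_at[OF 1])
  qed
  show ?thesis
    unfolding twice_differentiable_on_def
    using differentiableI_vector[OF 1] differentiableI_vector[OF 2] by blast
qed

lemma bounded_linear_affine_coords: "bounded_linear (\<lambda>p. affine_coords (fst p) (snd p))"
  by (rule linear_conv_bounded_linear[THEN iffD1])
    (auto intro!: linearI simp: affine_coords_def vec_eq_iff split: sum.split)

text \<open>Expansion in the standard basis turns the integrand into a finite sum of scalar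
  functions times fixed vectors.\<close>

lemma has_bochner_integral_vec:
  fixes g :: "'a \<Rightarrow> real ^ 'n"
  assumes "\<And>i. has_bochner_integral M (\<lambda>x. g x $ i) (v $ i)"
  shows "has_bochner_integral M g v"
proof -
  have axis: "(\<Sum>i\<in>UNIV. w $ i *\<^sub>R axis i 1) = w" for w :: "real ^ 'n"
    using basis_expansion[of w] by (simp add: scalar_mult_eq_scaleR)
  have "has_bochner_integral M (\<lambda>x. \<Sum>i\<in>UNIV. g x $ i *\<^sub>R axis i 1)
      (\<Sum>i\<in>UNIV. v $ i *\<^sub>R (axis i 1 :: real ^ 'n))"
    by (intro has_bochner_integral_sum has_bochner_integral_scaleR_left assms)
  then show ?thesis by (simp only: axis)
qed

lemma has_bochner_integral_matrix_vector_mult: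
  fixes G :: "'a \<Rightarrow> real ^ 'n ^ 'm"
  assumes "\<And>i j. has_bochner_integral M (\<lambda>x. G x $ i $ j) (N $ i $ j)"
  shows "has_bochner_integral M (\<lambda>x. G x *v v) (N *v v)"
  by (rule has_bochner_integral_vec)
    (auto simp: matrix_vector_mult_def intro!: has_bochner_integral_sum has_bochner_integral_mult_left assms)

lemma outer_nth: "outer x $ k $ l = x $ k * x $ l"
  by (simp add: matrix_matrix_mult_def columnvector_def rowvector_def)

text \<open>The factors \<open>mat 1\<close> in the Jacobian are Kronecker deltas, so the sum over
  the three world coordinates collapses to at most one term.\<close>

lemma gram_jacobian_nth:
  "(transpose (jacobian x) ** jacobian x) $ i $ j =
    (case (i, j) of
       (Inl k, Inl l) \<Rightarrow> if k = l then 1 else 0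
     | (Inl k, Inr (s, l)) \<Rightarrow> if k = s then x $ l else 0
     | (Inr (r, k), Inl l) \<Rightarrow> if r = l then x $ k else 0
     | (Inr (r, k), Inr (s, l)) \<Rightarrow> if r = s then x $ k * x $ l else 0)"
  by (auto simp: matrix_matrix_mult_def transpose_def jacobian_def mat_def
      if_distrib[of "\<lambda>z. z * _"] if_distrib[of "\<lambda>z. _ * z"] cong: if_cong split: sum.split)

text \<open>Since |x_k| \<le> 1 + x_k^2, the zeroth and second moments together dominate the
  first.\<close>

lemma set_integrable_first_moment:
  fixes \<rho> :: "real^'n \<Rightarrow> real"
  assumes 0: "set_integrable lebesgue \<Omega> \<rho>"
    and 2: "set_integrable lebesgue \<Omega> (\<lambda>x. \<rho> x * (x $ k * x $ k))"
  shows "set_integrable lebesgue \<Omega> (\<lambda>x. \<rho> x * x $ k)"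
proof -
  \<comment> \<open>The indicator stays attached to \<open>\<rho>\<close>, because nothing is known
    about the density outside the body.\<close>
  have meas: "(\<lambda>x. indicator \<Omega> x *\<^sub>R \<rho> x) \<in> borel_measurable lebesgue"
    using 0 unfolding set_integrable_def by (rule borel_measurable_integrable)
  have nth: "(\<lambda>x::real^'n. x $ k) \<in> borel_measurable lebesgue"
    by (intro measurable_completion) simp
  have int: "integrable lebesgue
      (\<lambda>x. norm (indicator \<Omega> x *\<^sub>R \<rho> x) + norm (indicator \<Omega> x *\<^sub>R (\<rho> x * (x $ k * x $ k))))"
    using 0 2 unfolding set_integrable_def
    by (intro Bochner_Integration.integrable_add integrable_norm)
  have meas1: "(\<lambda>x. indicator \<Omega> x *\<^sub>R (\<rho> x * x $ k)) \<in> borel_measurable lebesgue"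
    using borel_measurable_times[OF meas nth] by (simp add: mult.assoc)
  have "norm (indicator \<Omega> x *\<^sub>R (\<rho> x * x $ k))
      \<le> norm (norm (indicator \<Omega> x *\<^sub>R \<rho> x) + norm (indicator \<Omega> x *\<^sub>R (\<rho> x * (x $ k * x $ k))))" for x
  proof -
    \<comment> \<open>This is (|x_k| - 1)^2 \<ge> 0 expanded.\<close>
    have "2 * \<bar>x $ k\<bar> \<le> 1 + x $ k * x $ k"
      using zero_le_power2[of "\<bar>x $ k\<bar> - 1"] by (simp add: power2_eq_square algebra_simps)
    then have "\<bar>x $ k\<bar> \<le> 1 + x $ k * x $ k"
      by linarith
    from mult_left_mono[OF this abs_ge_zero[of "indicator \<Omega> x * \<rho> x"]] show ?thesis
      by (simp add: abs_mult algebra_simps)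
  qed
  then show ?thesis
    unfolding set_integrable_def
    by (intro Bochner_Integration.integrable_bound[OF int meas1] AE_I2)
qed

text \<open>Working entry by entry, the zeroth moment gives the mass block, the second moments give
  the inertia blocks, and the first moments, which couple translation to the linear part, vanish by
  \<open>center\<close>.\<close>

lemma has_bochner_integral_mass_matrix:
  assumes 0: "set_integrable lebesgue \<Omega> \<rho>"
    and 2: "set_integrable lebesgue \<Omega> (\<lambda>x. \<rho> x *\<^sub>R outer x)"
    and center: "(LINT x:\<Omega>|lebesgue. \<rho> x *\<^sub>R x) = 0"
  shows "has_bochner_integral lebesgue
    (\<lambda>x. (indicator \<Omega> x *\<^sub>R (\<rho> x *\<^sub>R (transpose (jacobian x) ** jacobian x))) $ i $ j)
    (mass_matrix \<Omega> \<rho> $ i $ j)"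
proof -
  have B0: "has_bochner_integral lebesgue (\<lambda>x. indicator \<Omega> x * \<rho> x) (mass \<Omega> \<rho>)"
    using 0 by (simp add: mass_def set_integrable_def set_lebesgue_integral_def
        has_bochner_integral_integrable)
  have "has_bochner_integral lebesgue (\<lambda>x. indicator \<Omega> x *\<^sub>R \<rho> x *\<^sub>R outer x) (affine_inertia \<Omega> \<rho>)"
    using 2 by (simp add: affine_inertia_def set_integrable_def set_lebesgue_integral_def
        has_bochner_integral_integrable)
  then have "has_bochner_integral lebesgue (\<lambda>x. (indicator \<Omega> x *\<^sub>R \<rho> x *\<^sub>R outer x) $ k $ l)
      (affine_inertia \<Omega> \<rho> $ k $ l)" for k l
    by (intro has_bochner_integral_bounded_linear[OF bounded_linear_vec_nth])
  then have B2: "has_bochner_integral lebesgue (\<lambda>x. indicator \<Omega> x * (\<rho> x * (x $ k * x $ l)))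
      (affine_inertia \<Omega> \<rho> $ k $ l)" for k l
    by (simp add: outer_nth mult.assoc)
  \<comment> \<open>The diagonal second moments, \<open>B2\<close> with equal indices, feed the
    domination argument.\<close>
  have I1: "integrable lebesgue (\<lambda>x. indicator \<Omega> x * (\<rho> x * x $ k))" for k
    using set_integrable_first_moment[OF 0, of k] B2[of k k]
    by (auto simp: set_integrable_def has_bochner_integral_iff)
  \<comment> \<open>A Bochner integral is 0 by default when the integrand is not integrable, so
    \<open>center\<close> says something about the components only once \<open>I1\<close> is
    known.\<close>
  have "has_bochner_integral lebesgue (\<lambda>x. indicator \<Omega> x *\<^sub>R \<rho> x *\<^sub>R x)
      (\<chi> k. LINT x|lebesgue. indicator \<Omega> x * (\<rho> x * x $ k))"
    using I1 by (intro has_bochner_integral_vec) (simp add: mult.assoc has_bochner_integral_integrable)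
  then have "(\<chi> k. LINT x|lebesgue. indicator \<Omega> x * (\<rho> x * x $ k)) = 0"
    using center by (simp add: has_bochner_integral_iff set_lebesgue_integral_def)
  then have "(LINT x|lebesgue. indicator \<Omega> x * (\<rho> x * x $ k)) = 0" for k
    by (simp add: vec_eq_iff)
  then have B1: "has_bochner_integral lebesgue (\<lambda>x. indicator \<Omega> x * (\<rho> x * x $ k)) 0" for k
    using I1 by (simp add: has_bochner_integral_iff)
  \<comment> \<open>Here \<open>b\<close> stands for the Kronecker condition in the mixed entries of
    \<open>gram_jacobian_nth\<close>.\<close>
  have B1_if: "has_bochner_integral lebesgue
      (\<lambda>x. if b then indicator \<Omega> x * (\<rho> x * x $ k) else 0) 0" for b k
    using B1 by (cases b) (simp_all add: has_bochner_integral_zero)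
  show ?thesis
    using B0 B1_if B2
    by (auto simp: gram_jacobian_nth mass_matrix_def mat_def has_bochner_integral_zero mult.assoc
        if_distrib[of "\<lambda>z. _ * z"] cong: if_cong split: sum.split)
qed

text \<open>Integration against a Dirac measure is evaluation at its point, where the indicator
  equals 1; continuity of \<open>g\<close> supplies measurability.\<close>

lemma set_integral_return_lebesgue:
  fixes g :: "'a::euclidean_space \<Rightarrow> 'b::{banach, second_countable_topology}"
  assumes "\<Omega> \<in> sets lebesgue" and "continuous_on UNIV g" and "a \<in> \<Omega>"
  shows "(LINT x:\<Omega>|return lebesgue a. g x) = g a"
proof -
  have "g \<in> borel_measurable lebesgue"
    using assms(2) by (intro measurable_completion) (simp add: borel_measurable_continuous_onI)
  then have "(\<lambda>x. indicator \<Omega> x *\<^sub>R g x) \<in> borel_measurable lebesgue"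
    using assms(1) by (intro borel_measurable_scaleR borel_measurable_indicator)
  then show ?thesis
    using assms(3) by (simp add: set_lebesgue_integral_def integral_return)
qed

lemma continuous_on_transpose_jacobian: "continuous_on S (\<lambda>x. transpose (jacobian x) *v v)"
proof -
  have "continuous_on S (\<lambda>x. jacobian x $ r $ j)" for r j
    by (cases j) (auto simp: jacobian_def intro!: continuous_intros)
  then show ?thesis
    unfolding matrix_vector_mult_def transpose_def
    by (auto intro!: continuous_on_vec_lambda continuous_on_sum continuous_on_mult)
qed

theorem theorem1:
  fixes \<Omega> :: "(real^3) set" and \<rho> :: "real^3 \<Rightarrow> real"
    and A :: "real \<Rightarrow> real^3^3" and c :: "real \<Rightarrow> real^3"
    and T :: "real set" and t :: real
    and P :: "'p set" and X f :: "'p \<Rightarrow> real^3"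
  assumes "\<Omega> \<in> sets lebesgue"
    and "\<And>x. x \<in> \<Omega> \<Longrightarrow> 0 \<le> \<rho> x"
    and "set_integrable lebesgue \<Omega> \<rho>"
    and "set_integrable lebesgue \<Omega> (\<lambda>x. \<rho> x *\<^sub>R outer x)"
    and center_of_mass: "(LINT x:\<Omega>|lebesgue. \<rho> x *\<^sub>R x) = 0"
    and "open T" and "t \<in> T"
    and "twice_differentiable_on A T" and "twice_differentiable_on c T"
    and "finite P" and "\<And>p. p \<in> P \<Longrightarrow> X p \<in> \<Omega>"
  shows "newton_affine \<Omega> \<rho> (\<lambda>s. world (A s) (c s)) (concentrated \<Omega> P X f) t \<longleftrightarrow>
    mass_matrix \<Omega> \<rho> *v acceleration (\<lambda>s. affine_coords (A s) (c s)) t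
      = (\<Sum>p\<in>P. transpose (jacobian (X p)) *v f p)"
proof -
  let ?q = "\<lambda>s. affine_coords (A s) (c s)"
  have q: "twice_differentiable_on ?q T"
    using twice_differentiable_on_bounded_linear(1)[OF bounded_linear_affine_coords \<open>open T\<close>
        twice_differentiable_on_Pair[OF \<open>open T\<close> \<open>twice_differentiable_on A T\<close>
          \<open>twice_differentiable_on c T\<close>]]
    by simp
  have acc: "acceleration (\<lambda>s. world (A s) (c s) x) t = jacobian x *v acceleration ?q t" for x
    unfolding world_eq_jacobian
    by (rule twice_differentiable_on_bounded_linear(2)
        [OF matrix_vector_mul_bounded_linear \<open>open T\<close> q \<open>t \<in> T\<close>])
  have "has_bochner_integral lebesgue
      (\<lambda>x. (indicator \<Omega> x *\<^sub>R (\<rho> x *\<^sub>R (transpose (jacobian x) ** jacobian x))) *v acceleration ?q t)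
      (mass_matrix \<Omega> \<rho> *v acceleration ?q t)"
    by (intro has_bochner_integral_matrix_vector_mult has_bochner_integral_mass_matrix assms)
  then have lhs: "(LINT x:\<Omega>|lebesgue. transpose (jacobian x) *v
        (\<rho> x *\<^sub>R acceleration (\<lambda>s. world (A s) (c s) x) t))
      = mass_matrix \<Omega> \<rho> *v acceleration ?q t"
    \<comment> \<open>Pulling all scalars out and merging the two matrix actions into one product
      brings both integrands to the same normal form.\<close>
    by (simp add: acc has_bochner_integral_iff set_lebesgue_integral_def matrix_vector_mul_assoc
        scaleR_matrix_vector_assoc[symmetric] matrix_vector_mult_scaleR)
  have rhs: "concentrated \<Omega> P X f (\<lambda>x. transpose (jacobian x))
      = (\<Sum>p\<in>P. transpose (jacobian (X p)) *v f p)"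
    unfolding concentrated_def
    by (intro sum.cong refl set_integral_return_lebesgue continuous_on_transpose_jacobian assms)
  show ?thesis
    \<comment> \<open>Each side of the integrated law equals the corresponding side of the matrix
      equation, so both directions follow at once.\<close>
    by (simp only: newton_affine_def lhs rhs)
qed

end
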